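(* Let $M$ be a complete locally compact CAT(0)-space and let $X$ be an asymptotic cone of $M$. Let $k\ge1$, let $\gamma$ be a $k$-flat of $M$ (possibly a geodesic, i.e. $k=1$), and let $\gamma_\omega$ be its limit in $X$. If $\gamma_\omega$ bounds a $(k+1)$-dimensional half-flat in $X$, then $\gamma$ itself bounds a $(k+1)$-dimensional half-flat in $M$.
   Context: Flats and half-flats. A $k$-flat ($k\ge1$) in a CAT(0)-space is an isometrically embedded copy of the standard Euclidean space $\mathbb{R}^k$ (for $k=1$: a bi-infinite geodesic). A $(k+1)$-dimensional half-flat is an isometrically embedded copy of $\mathbb{R}^{k}\times[0,\infty)$. A $k$-flat $\gamma$ bounds a $(k+1)$-dimensional half-flat if there is an isometric embedding of $\mathbb{R}^k\times[0,\infty)$ into the space mapping $\mathbb{R}^k\times\{0\}$ onto $\gamma$. Asymptotic cones. Let $\omega$ be a non-principal ultrafilter on $\mathbb{N}$, let $(M,d,* )$ be a pointed metric space, and let $\lambda_j\in(0,\infty)$ be a sequence of scaling factors with $\omega\lim\lambda_j=\infty$. For sequences $\{x_j\},\{y_j\}$ in $M$ set $d_\omega(\{x_j\},\{y_j\})=\omega\lim d(x_j,y_j)/\lambda_j\in[0,\infty]$. The asymptotic cone $X=\mathrm{Cone}(M)$ is the set of sequences $\{x_j\}$ with $d_\omega(\{x_j\},\{*\})<\infty$, modulo identifying sequences at $d_\omega$-distance $0$, with metric $d_\omega$. "An asymptotic cone" means one obtained from some choice of basepoint, scaling sequence and ultrafilter. If $M$ is CAT(0), so is $X$. If $\gamma\subset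 M$ is a $k$-flat, its limit $\gamma_\omega\subset X$ is the set of points of $X$ represented by sequences of points in $\gamma$; it is a $k$-flat of $X$. *)

theory Defs
  imports "HOL-Analysis.Analysis"
begin

section \<open>CAT(0) spaces\<close>

definition isometric_embedding_on :: "'b::metric_space set \<Rightarrow> 'a metric \<Rightarrow> ('b \<Rightarrow> 'a) \<Rightarrow> bool" where
  "isometric_embedding_on D M f \<longleftrightarrow>
     f ` D \<subseteq> mspace M \<and> (\<forall>x\<in>D. \<forall>y\<in>D. mdist M (f x) (f y) = dist x y)"

definition geodesic_segment :: "'a metric \<Rightarrow> 'a \<Rightarrow> 'a \<Rightarrow> 'a set \<Rightarrow> bool" where
  "geodesic_segment M x y S \<longleftrightarrow>
     (\<exists>c. isometric_embedding_on {0..mdist M x y} M c \<and>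
          c 0 = x \<and> c (mdist M x y) = y \<and> S = c ` {0..mdist M x y})"

definition geodesic_space :: "'a metric \<Rightarrow> bool" where
  "geodesic_space M \<longleftrightarrow> (\<forall>x\<in>mspace M. \<forall>y\<in>mspace M. \<exists>S. geodesic_segment M x y S)"

text \<open>The point \<open>p'\<close> of the Euclidean segment from \<open>x'\<close> to \<open>y'\<close> is a comparison point
  for the point \<open>p\<close> of the geodesic segment \<open>S\<close> from \<open>x\<close> to \<open>y\<close>.\<close>

definition comparison_point ::
  "'a metric \<Rightarrow> 'a \<Rightarrow> 'a \<Rightarrow> 'a set \<Rightarrow> real^2 \<Rightarrow> real^2 \<Rightarrow> 'a \<Rightarrow> real^2 \<Rightarrow> bool" where
  "comparison_point M x y S x' y' p p' \<longleftrightarrow>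
     p \<in> S \<and> p' \<in> closed_segment x' y' \<and> mdist M x p = dist x' p'"

definition CAT0_triangle ::
  "'a metric \<Rightarrow> 'a \<Rightarrow> 'a \<Rightarrow> 'a \<Rightarrow> 'a set \<Rightarrow> 'a set \<Rightarrow> 'a set \<Rightarrow> bool" where
  "CAT0_triangle M x y z S T U \<longleftrightarrow>
     (\<forall>x' y' z'.
        dist x' y' = mdist M x y \<and> dist y' z' = mdist M y z \<and> dist z' x' = mdist M z x \<longrightarrow>
        (let cmp = (\<lambda>p p'. comparison_point M x y S x' y' p p' \<or>
                           comparison_point M y z T y' z' p p' \<or>
                           comparison_point M z x U z' x' p p')
         in \<forall>p q p' q'. cmp p p' \<and> cmp q q' \<longrightarrow> mdist M p q \<le> dist p' q'))"

definition CAT0_space :: "'a metric \<Rightarrow> bool" where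
  "CAT0_space M \<longleftrightarrow> geodesic_space M \<and>
     (\<forall>x\<in>mspace M. \<forall>y\<in>mspace M. \<forall>z\<in>mspace M. \<forall>S T U.
        geodesic_segment M x y S \<and> geodesic_segment M y z T \<and> geodesic_segment M z x U \<longrightarrow>
        CAT0_triangle M x y z S T U)"

section \<open>Flats and half-flats\<close>

text \<open>The dimension \<open>k \<ge> 1\<close> is the cardinality of the index type \<open>'k\<close>. The distance on
  \<open>(real^'k) \<times> real\<close> is the Euclidean one.\<close>

definition flat :: "'k::finite itself \<Rightarrow> 'a metric \<Rightarrow> 'a set \<Rightarrow> bool" where
  "flat _ M \<gamma> \<longleftrightarrow> (\<exists>f :: real^'k \<Rightarrow> 'a. isometric_embedding_on UNIV M f \<and> \<gamma> = range f)"

definition bounds_half_flat :: "'k::finite itself \<Rightarrow> 'a metric \<Rightarrow> 'a set \<Rightarrow> bool" where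
  "bounds_half_flat _ M \<gamma> \<longleftrightarrow>
     (\<exists>h :: (real^'k) \<times> real \<Rightarrow> 'a.
        isometric_embedding_on (UNIV \<times> {0..}) M h \<and> h ` (UNIV \<times> {0}) = \<gamma>)"

section \<open>Asymptotic cones\<close>

definition nonprincipal_ultrafilter :: "'i filter \<Rightarrow> bool" where
  "nonprincipal_ultrafilter \<omega> \<longleftrightarrow>
     \<omega> \<noteq> bot \<and> (\<forall>P. eventually P \<omega> \<or> eventually (\<lambda>i. \<not> P i) \<omega>) \<and> (\<forall>i. \<omega> \<noteq> principal {i})"

definition dist_omega ::
  "'a metric \<Rightarrow> (nat \<Rightarrow> real) \<Rightarrow> nat filter \<Rightarrow> (nat \<Rightarrow> 'a) \<Rightarrow> (nat \<Rightarrow> 'a) \<Rightarrow> ereal" where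
  "dist_omega M lam \<omega> x y = Lim \<omega> (\<lambda>j. ereal (mdist M (x j) (y j) / lam j))"

definition cone_seqs ::
  "'a metric \<Rightarrow> 'a \<Rightarrow> (nat \<Rightarrow> real) \<Rightarrow> nat filter \<Rightarrow> (nat \<Rightarrow> 'a) set" where
  "cone_seqs M b lam \<omega> = {x. range x \<subseteq> mspace M \<and> dist_omega M lam \<omega> x (\<lambda>_. b) < \<infinity>}"

definition cone_rel ::
  "'a metric \<Rightarrow> 'a \<Rightarrow> (nat \<Rightarrow> real) \<Rightarrow> nat filter \<Rightarrow> ((nat \<Rightarrow> 'a) \<times> (nat \<Rightarrow> 'a)) set" where
  "cone_rel M b lam \<omega> =
     {(x, y). x \<in> cone_seqs M b lam \<omega> \<and> y \<in> cone_seqs M b lam \<omega> \<and> dist_omega M lam \<omega> x y = 0}"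

definition cone_dist ::
  "'a metric \<Rightarrow> (nat \<Rightarrow> real) \<Rightarrow> nat filter \<Rightarrow> (nat \<Rightarrow> 'a) set \<Rightarrow> (nat \<Rightarrow> 'a) set \<Rightarrow> real" where
  "cone_dist M lam \<omega> A B =
     real_of_ereal (dist_omega M lam \<omega> (SOME x. x \<in> A) (SOME y. y \<in> B))"

text \<open>The value is meaningful only under the assumptions of the locale \<open>cone_data\<close> below; see
  \<open>mspace_asymptotic_cone\<close> and \<open>mdist_asymptotic_cone\<close>.\<close>

definition asymptotic_cone ::
  "'a metric \<Rightarrow> 'a \<Rightarrow> (nat \<Rightarrow> real) \<Rightarrow> nat filter \<Rightarrow> (nat \<Rightarrow> 'a) set metric" where
  "asymptotic_cone M b lam \<omega> =
     metric (cone_seqs M b lam \<omega> // cone_rel M b lam \<omega>, cone_dist M lam \<omega>)"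

definition cone_limit ::
  "'a metric \<Rightarrow> 'a \<Rightarrow> (nat \<Rightarrow> real) \<Rightarrow> nat filter \<Rightarrow> 'a set \<Rightarrow> (nat \<Rightarrow> 'a) set set" where
  "cone_limit M b lam \<omega> \<gamma> =
     {A \<in> mspace (asymptotic_cone M b lam \<omega>). \<exists>x\<in>A. range x \<subseteq> \<gamma>}"

section \<open>The asymptotic cone is a metric space\<close>

lemma ultrafilter_tendsto_Lim:
  fixes f :: "'i \<Rightarrow> ereal"
  assumes "nonprincipal_ultrafilter \<omega>"
  shows "(f \<longlongrightarrow> Lim \<omega> f) \<omega>"
proof -
  have nb: "\<omega> \<noteq> bot" and ul: "\<And>P. eventually P \<omega> \<or> eventually (\<lambda>i. \<not> P i) \<omega>"
    using assms by (auto simp: nonprincipal_ultrafilter_def)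
  have "filtermap f \<omega> \<noteq> bot" using nb by (simp add: filtermap_bot_iff)
  then obtain l where l: "inf (nhds l) (filtermap f \<omega>) \<noteq> bot"
    using compact_UNIV[where 'a=ereal, unfolded compact_filter, rule_format, of "filtermap f \<omega>"]
    by auto
  have "(f \<longlongrightarrow> l) \<omega>"
  proof (rule topological_tendstoI, rule ccontr)
    fix S assume S: "open S" "l \<in> S" "\<not> eventually (\<lambda>x. f x \<in> S) \<omega>"
    then have "eventually (\<lambda>y. y \<notin> S) (filtermap f \<omega>)"
      using ul[of "\<lambda>x. f x \<in> S"] by (simp add: eventually_filtermap)
    moreover have "eventually (\<lambda>y. y \<in> S) (nhds l)"
      using S by (simp add: eventually_nhds_in_open)
    ultimately have "eventually (\<lambda>_. False) (inf (nhds l) (filtermap f \<omega>))"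
      unfolding eventually_inf by blast
    with l show False by (simp add: trivial_limit_def)
  qed
  with nb show ?thesis by (metis tendsto_Lim)
qed

locale cone_data =
  fixes M :: "'a metric" and b :: 'a and lam :: "nat \<Rightarrow> real" and \<omega> :: "nat filter"
  assumes b: "b \<in> mspace M"
    and \<omega>: "nonprincipal_ultrafilter \<omega>"
    and lam: "\<And>j. 0 < lam j"
begin

lemma nb: "\<omega> \<noteq> bot"
  using \<omega> by (simp add: nonprincipal_ultrafilter_def)

lemma dist_omega_lim:
  "((\<lambda>j. ereal (mdist M (x j) (y j) / lam j)) \<longlongrightarrow> dist_omega M lam \<omega> x y) \<omega>"
  unfolding dist_omega_def by (rule ultrafilter_tendsto_Lim[OF \<omega>])

lemma dist_omega_nonneg: "0 \<le> dist_omega M lam \<omega> x y"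
  by (rule tendsto_lowerbound[OF dist_omega_lim _ nb])
     (simp add: less_imp_le[OF lam])

lemma dist_omega_commute: "dist_omega M lam \<omega> x y = dist_omega M lam \<omega> y x"
  by (simp add: dist_omega_def mdist_commute)

lemma dist_omega_refl:
  assumes "range x \<subseteq> mspace M"
  shows "dist_omega M lam \<omega> x x = 0"
proof -
  have "(\<lambda>j. ereal (mdist M (x j) (x j) / lam j)) = (\<lambda>_. 0)"
    using assms by (auto simp: fun_eq_iff image_subset_iff zero_ereal_def)
  then show ?thesis
    unfolding dist_omega_def by (simp add: tendsto_Lim[OF nb tendsto_const])
qed

lemma dist_omega_triangle:
  assumes "range x \<subseteq> mspace M" "range y \<subseteq> mspace M" "range z \<subseteq> mspace M"
  shows "dist_omega M lam \<omega> x z \<le> dist_omega M lam \<omega> x y + dist_omega M lam \<omega> y z"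
proof -
  have lim: "((\<lambda>j. ereal (mdist M (x j) (y j) / lam j) + ereal (mdist M (y j) (z j) / lam j))
         \<longlongrightarrow> dist_omega M lam \<omega> x y + dist_omega M lam \<omega> y z) \<omega>"
    by (rule tendsto_add_ereal_general[OF _ dist_omega_lim dist_omega_lim])
       (use dist_omega_nonneg[of x y] dist_omega_nonneg[of y z] in auto)
  show ?thesis
  proof (rule tendsto_le[OF nb lim dist_omega_lim], rule always_eventually, rule allI)
    fix j
    have "mdist M (x j) (z j) \<le> mdist M (x j) (y j) + mdist M (y j) (z j)"
      by (rule mdist_triangle) (use assms in auto)
    then show "ereal (mdist M (x j) (z j) / lam j)
      \<le> ereal (mdist M (x j) (y j) / lam j) + ereal (mdist M (y j) (z j) / lam j)"
      using lam[of j] by (simp add: divide_right_mono flip: add_divide_distrib)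
  qed
qed

lemma cone_seqsD: "x \<in> cone_seqs M b lam \<omega> \<Longrightarrow> range x \<subseteq> mspace M"
  by (simp add: cone_seqs_def)

lemma dist_omega_finite:
  assumes "x \<in> cone_seqs M b lam \<omega>" "y \<in> cone_seqs M b lam \<omega>"
  shows "\<bar>dist_omega M lam \<omega> x y\<bar> \<noteq> \<infinity>"
proof -
  have "dist_omega M lam \<omega> x y \<le> dist_omega M lam \<omega> x (\<lambda>_. b) + dist_omega M lam \<omega> (\<lambda>_. b) y"
    using assms b by (intro dist_omega_triangle) (auto simp: cone_seqs_def)
  also have "\<dots> < \<infinity>"
    using assms dist_omega_commute[of y] by (auto simp: cone_seqs_def)
  finally show ?thesis using dist_omega_nonneg[of x y] by auto
qed

lemma equiv_cone_rel: "equiv (cone_seqs M b lam \<omega>) (cone_rel M b lam \<omega>)"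
proof (rule equivI)
  show "cone_rel M b lam \<omega> \<subseteq> cone_seqs M b lam \<omega> \<times> cone_seqs M b lam \<omega>"
    by (auto simp: cone_rel_def)
  show "refl_on (cone_seqs M b lam \<omega>) (cone_rel M b lam \<omega>)"
    by (auto simp: refl_on_def cone_rel_def intro!: dist_omega_refl dest: cone_seqsD)
  show "sym (cone_rel M b lam \<omega>)"
    by (auto simp: sym_def cone_rel_def dist_omega_commute)
  show "trans (cone_rel M b lam \<omega>)"
  proof (rule transI)
    fix x y z assume "(x, y) \<in> cone_rel M b lam \<omega>" "(y, z) \<in> cone_rel M b lam \<omega>"
    then show "(x, z) \<in> cone_rel M b lam \<omega>"
      using dist_omega_triangle[of x y z] dist_omega_nonneg[of x z]
      by (auto simp: cone_rel_def dest!: cone_seqsD)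
  qed
qed

lemma dist_omega_cong:
  assumes "(x, x') \<in> cone_rel M b lam \<omega>" "(y, y') \<in> cone_rel M b lam \<omega>"
  shows "dist_omega M lam \<omega> x y = dist_omega M lam \<omega> x' y'"
proof -
  have le: "dist_omega M lam \<omega> u v \<le> dist_omega M lam \<omega> u' v'"
    if "(u, u') \<in> cone_rel M b lam \<omega>" "(v, v') \<in> cone_rel M b lam \<omega>" for u u' v v'
  proof -
    have r: "range u \<subseteq> mspace M" "range u' \<subseteq> mspace M" "range v \<subseteq> mspace M" "range v' \<subseteq> mspace M"
      using that by (auto simp: cone_rel_def dest: cone_seqsD)
    have "dist_omega M lam \<omega> u v \<le> dist_omega M lam \<omega> u' v"
      using dist_omega_triangle[of u u' v] r that by (simp add: cone_rel_def)
    also have "\<dots> \<le> dist_omega M lam \<omega> u' v'"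
      using dist_omega_triangle[of u' v' v] dist_omega_commute[of v' v] r that
      by (simp add: cone_rel_def)
    finally show ?thesis .
  qed
  have "(x', x) \<in> cone_rel M b lam \<omega>" "(y', y) \<in> cone_rel M b lam \<omega>"
    using assms equiv_cone_rel by (auto simp: equiv_def dest: symD)
  with assms le show ?thesis by (meson order_antisym)
qed

lemma some_in_class:
  assumes "A \<in> cone_seqs M b lam \<omega> // cone_rel M b lam \<omega>"
  shows "(SOME x. x \<in> A) \<in> A" "(SOME x. x \<in> A) \<in> cone_seqs M b lam \<omega>"
proof -
  have "A \<noteq> {}" using assms equiv_cone_rel by (meson in_quotient_imp_non_empty)
  then show 1: "(SOME x. x \<in> A) \<in> A" by (simp add: some_in_eq)
  have "A \<subseteq> cone_seqs M b lam \<omega>" using assms equiv_cone_rel by (meson in_quotient_imp_subset)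
  with 1 show "(SOME x. x \<in> A) \<in> cone_seqs M b lam \<omega>" by blast
qed

lemma cone_dist_rep:
  assumes "A \<in> cone_seqs M b lam \<omega> // cone_rel M b lam \<omega>" "x \<in> A"
    and "B \<in> cone_seqs M b lam \<omega> // cone_rel M b lam \<omega>" "y \<in> B"
  shows "ereal (cone_dist M lam \<omega> A B) = dist_omega M lam \<omega> x y"
proof -
  let ?x = "SOME x. x \<in> A" and ?y = "SOME y. y \<in> B"
  have "(?x, x) \<in> cone_rel M b lam \<omega>" "(?y, y) \<in> cone_rel M b lam \<omega>"
    using assms some_in_class equiv_cone_rel by (meson in_quotient_imp_in_rel insert_subset empty_subsetI)+
  then have "dist_omega M lam \<omega> ?x ?y = dist_omega M lam \<omega> x y"
    by (rule dist_omega_cong)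
  then show ?thesis
    using dist_omega_finite[OF some_in_class(2)[OF assms(1)] some_in_class(2)[OF assms(3)]]
    by (simp add: cone_dist_def ereal_real)
qed

lemma Metric_space_cone:
  "Metric_space (cone_seqs M b lam \<omega> // cone_rel M b lam \<omega>) (cone_dist M lam \<omega>)"
proof
  fix A B
  show "0 \<le> cone_dist M lam \<omega> A B"
    by (simp add: cone_dist_def dist_omega_nonneg real_of_ereal_pos)
  show "cone_dist M lam \<omega> A B = cone_dist M lam \<omega> B A"
    by (simp add: cone_dist_def dist_omega_commute)
next
  fix A B assume A: "A \<in> cone_seqs M b lam \<omega> // cone_rel M b lam \<omega>"
    and B: "B \<in> cone_seqs M b lam \<omega> // cone_rel M b lam \<omega>"
  let ?x = "SOME x. x \<in> A" and ?y = "SOME y. y \<in> B"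
  have "cone_dist M lam \<omega> A B = 0 \<longleftrightarrow> dist_omega M lam \<omega> ?x ?y = 0"
    using cone_dist_rep[OF A some_in_class(1)[OF A] B some_in_class(1)[OF B]]
    by (metis ereal_eq_0(1))
  also have "\<dots> \<longleftrightarrow> (?x, ?y) \<in> cone_rel M b lam \<omega>"
    using some_in_class(2)[OF A] some_in_class(2)[OF B] by (simp add: cone_rel_def)
  also have "\<dots> \<longleftrightarrow> A = B"
    using quotient_eq_iff[OF equiv_cone_rel A B some_in_class(1)[OF A] some_in_class(1)[OF B]]
    by simp
  finally show "cone_dist M lam \<omega> A B = 0 \<longleftrightarrow> A = B" .
next
  fix A B C assume A: "A \<in> cone_seqs M b lam \<omega> // cone_rel M b lam \<omega>"
    and B: "B \<in> cone_seqs M b lam \<omega> // cone_rel M b lam \<omega>"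
    and C: "C \<in> cone_seqs M b lam \<omega> // cone_rel M b lam \<omega>"
  note a = some_in_class[OF A] and b' = some_in_class[OF B] and c = some_in_class[OF C]
  have "ereal (cone_dist M lam \<omega> A C) \<le> ereal (cone_dist M lam \<omega> A B) + ereal (cone_dist M lam \<omega> B C)"
    using dist_omega_triangle[OF cone_seqsD[OF a(2)] cone_seqsD[OF b'(2)] cone_seqsD[OF c(2)]]
    by (simp only: cone_dist_rep[OF A a(1) C c(1)] cone_dist_rep[OF A a(1) B b'(1)]
        cone_dist_rep[OF B b'(1) C c(1)])
  then show "cone_dist M lam \<omega> A C \<le> cone_dist M lam \<omega> A B + cone_dist M lam \<omega> B C"
    by simp
qed

lemma mspace_asymptotic_cone:
  "mspace (asymptotic_cone M b lam \<omega>) = cone_seqs M b lam \<omega> // cone_rel M b lam \<omega>"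
  by (simp add: asymptotic_cone_def Metric_space.mspace_metric[OF Metric_space_cone])

lemma mdist_asymptotic_cone:
  assumes "A \<in> mspace (asymptotic_cone M b lam \<omega>)" "x \<in> A"
    and "B \<in> mspace (asymptotic_cone M b lam \<omega>)" "y \<in> B"
  shows "ereal (mdist (asymptotic_cone M b lam \<omega>) A B) = dist_omega M lam \<omega> x y"
  using assms cone_dist_rep unfolding mspace_asymptotic_cone
  by (simp add: asymptotic_cone_def Metric_space.mdist_metric[OF Metric_space_cone])

end

end

theory Submission
  imports Defs
begin

text \<open>
  Let \<open>f\<close> parametrise the flat \<open>\<gamma>\<close>. The proof looks for points \<open>p\<^sub>j\<close> of \<open>M\<close> that run to infinity
  orthogonally to \<open>\<gamma>\<close>, and obtains the half-flat as the union of the limits, along \<open>\<omega>\<close>, of the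
  geodesics from the points of \<open>\<gamma>\<close> to \<open>p\<^sub>j\<close>.

  The points come from the cone. The constant sequence \<open>f 0\<close> is a point of \<open>\<gamma>\<^sub>\<omega>\<close>; let \<open>p\<^sub>j\<close>
  represent the point of the half-flat at height 1 over it. By Pythagoras in the half-flat,
  \<open>d(p\<^sub>j, f(\<lambda>\<^sub>j x)) / \<lambda>\<^sub>j\<close> tends to \<open>sqrt (1 + |x|\<^sup>2)\<close> for every \<open>x\<close>
  (\<open>height_one_sequence\<close>). So the squared distance to \<open>p\<^sub>j\<close>, restricted to \<open>\<gamma>\<close>, is Euclidean up
  to \<open>o(\<lambda>\<^sub>j\<^sup>2)\<close> at the scale \<open>\<lambda>\<^sub>j\<close>. In a CAT(0) space this function, minus \<open>|x|\<^sup>2\<close>, is convex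
  (\<open>CAT0_sq_dist_strongly_convex\<close>), and convexity carries the estimate from the scale \<open>\<lambda>\<^sub>j\<close> down to
  bounded scale: for fixed \<open>x\<close> and \<open>y\<close> the squared distances from \<open>p\<^sub>j\<close> to \<open>f x\<close> and \<open>f y\<close> differ by
  \<open>o(\<lambda>\<^sub>j)\<close>, and since both distances are asymptotic to \<open>\<lambda>\<^sub>j\<close>, the distances themselves differ by
  \<open>o(1)\<close> (\<open>receding_points_equidistant\<close>). In other words, a Busemann function that the \<open>p\<^sub>j\<close> define
  is constant on \<open>\<gamma>\<close>.

  Let \<open>H x a\<close> be the limit of the points at distance \<open>a\<close> from \<open>f x\<close> on the geodesics from \<open>f x\<close>
  to \<open>p\<^sub>j\<close>; local compactness and completeness make it exist (\<open>Lipschitz_paths_ultralimit_exists\<close>).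
  The comparison triangles of \<open>f x\<close>, \<open>f y\<close>, \<open>p\<^sub>j\<close> become half-strips of width \<open>|x - y|\<close>, which bounds
  the distances between points \<open>H x a\<close> and \<open>H y b\<close> from above by the Euclidean ones. They are also
  bounded from below: convexity along \<open>\<gamma>\<close> forces equality when \<open>b = 0\<close>, and then equality
  propagates, because a Euclidean segment that is not parallel to the boundary extends to one that
  ends on the boundary (\<open>half_flat_from_receding_points\<close>).
\<close>

section \<open>Strong convexity of squared distances\<close>

lemma comparison_triangle_exists:
  fixes a b c :: real
  assumes "0 \<le> a" "0 \<le> b" "0 \<le> c" "a \<le> b + c" "b \<le> c + a" "c \<le> a + b"
  shows "\<exists>x y z :: real^2. dist x y = a \<and> dist y z = b \<and> dist z x = c"
proof (cases "a = 0")
  case True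
  then have bc: "b = c" using assms by simp
  have "dist (0::real^2) (vector [c, 0]) = c"
    using assms by (simp add: dist_norm norm_eq_sqrt_inner inner_vec_def sum_2 power2_eq_square[symmetric])
  then show ?thesis using True bc
    by (metis dist_commute dist_self)
next
  case False
  with assms have a: "a > 0" by simp
  define u where "u = (a\<^sup>2 + c\<^sup>2 - b\<^sup>2) / (2 * a)"
  have ua: "2 * a * u = a\<^sup>2 + c\<^sup>2 - b\<^sup>2" using a by (simp add: u_def)
  have "b\<^sup>2 \<le> (c + a)\<^sup>2" "(a - c)\<^sup>2 \<le> b\<^sup>2"
    using assms by (auto intro: power_mono simp: abs_le_square_iff[symmetric])
  then have "2 * a * u \<le> 2 * a * c" "2 * a * (- c) \<le> 2 * a * u"
    unfolding ua by (simp_all add: power2_eq_square algebra_simps)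
  then have "u \<le> c" "- c \<le> u"
    using a mult_le_cancel_left_pos[of "2 * a"] by (metis mult_pos_pos zero_less_numeral)+
  then have "\<bar>u\<bar> \<le> \<bar>c\<bar>" by simp
  then have uc: "u\<^sup>2 \<le> c\<^sup>2" by (simp add: abs_le_square_iff)
  define x y z :: "real^2" where "x = 0" and "y = vector [a, 0]"
    and "z = vector [u, sqrt (c\<^sup>2 - u\<^sup>2)]"
  have "dist x y = a"
    using a by (simp add: x_def y_def dist_norm norm_eq_sqrt_inner inner_vec_def sum_2 power2_eq_square[symmetric])
  moreover have "dist z x = c"
    using assms uc by (simp add: x_def z_def dist_norm norm_eq_sqrt_inner inner_vec_def sum_2 power2_eq_square[symmetric])
  moreover have "(a - u)\<^sup>2 + (c\<^sup>2 - u\<^sup>2) = b\<^sup>2"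
    using ua by (simp add: power2_eq_square algebra_simps)
  then have "dist y z = b"
    using assms uc by (simp add: y_def z_def dist_norm norm_eq_sqrt_inner inner_vec_def sum_2 power2_eq_square[symmetric])
  ultimately show ?thesis by blast
qed

lemma dist_convex_combination_sq:
  fixes x y z :: "'b::real_inner"
  shows "(dist ((1 - t) *\<^sub>R x + t *\<^sub>R y) z)\<^sup>2
    = (1 - t) * (dist z x)\<^sup>2 + t * (dist z y)\<^sup>2 - t * (1 - t) * (dist x y)\<^sup>2"
  unfolding dist_norm power2_norm_eq_inner
  by (simp add: inner_commute algebra_simps inner_diff_left inner_diff_right inner_add_left inner_add_right)

text \<open>This is the comparison between a vertex and a point of the opposite side: the point of the
  comparison triangle satisfies Stewart's equation, so the point of \<open>M\<close> satisfies the
  corresponding inequality.\<close>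

lemma CAT0_geodesic_sq_convex:
  assumes M: "CAT0_space M" and c: "isometric_embedding_on {0..D} M c"
    and p: "p \<in> mspace M" and D: "0 \<le> D" and t: "0 \<le> t" "t \<le> 1"
  shows "(mdist M p (c (t * D)))\<^sup>2
    \<le> (1 - t) * (mdist M p (c 0))\<^sup>2 + t * (mdist M p (c D))\<^sup>2 - t * (1 - t) * D\<^sup>2"
proof -
  have tD: "t * D \<in> {0..D}"
    using t D by (auto simp: mult_left_le_one_le)
  have m: "c 0 \<in> mspace M" "c D \<in> mspace M" "c (t * D) \<in> mspace M"
    using c D tD unfolding isometric_embedding_on_def by auto
  have cd: "mdist M (c u) (c v) = \<bar>u - v\<bar>" if "u \<in> {0..D}" "v \<in> {0..D}" for u v
    using c that unfolding isometric_embedding_on_def by (simp add: dist_real_def)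
  have D': "mdist M (c 0) (c D) = D" using cd[of 0 D] D by simp
  have S: "geodesic_segment M (c 0) (c D) (c ` {0..D})"
    unfolding geodesic_segment_def D' using c by blast
  obtain T U where T: "geodesic_segment M (c D) p T" and U: "geodesic_segment M p (c 0) U"
    using M m p unfolding CAT0_space_def geodesic_space_def by meson
  have pU: "p \<in> U" using U unfolding geodesic_segment_def by force
  obtain x y z :: "real^2" where xyz: "dist x y = mdist M (c 0) (c D)"
    "dist y z = mdist M (c D) p" "dist z x = mdist M p (c 0)"
    using comparison_triangle_exists[of "mdist M (c 0) (c D)" "mdist M (c D) p" "mdist M p (c 0)"]
      mdist_triangle[of "c 0" M p "c D"] mdist_triangle[of "c D" M "c 0" p] mdist_triangle[of p M "c D" "c 0"]
      m p by (auto simp: mdist_commute add.commute)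
  have tri: "CAT0_triangle M (c 0) (c D) p (c ` {0..D}) T U"
    using M S T U m p unfolding CAT0_space_def by blast
  let ?q = "(1 - t) *\<^sub>R x + t *\<^sub>R y"
  have "?q \<in> closed_segment x y" using t by (auto simp: in_segment)
  moreover have "dist x ?q = t * dist x y"
  proof -
    have "x - ?q = t *\<^sub>R (x - y)" by (simp add: algebra_simps)
    then show ?thesis using t by (simp add: dist_norm)
  qed
  moreover have "mdist M (c 0) (c (t * D)) = t * D" using cd[of 0 "t * D"] tD D by simp
  ultimately have cq: "comparison_point M (c 0) (c D) (c ` {0..D}) x y (c (t * D)) ?q"
    using tD xyz D' unfolding comparison_point_def by simp
  have cp: "comparison_point M p (c 0) U z x p z"
    using pU p unfolding comparison_point_def by simp
  have "mdist M (c (t * D)) p \<le> dist ?q z"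
    using tri xyz cq cp unfolding CAT0_triangle_def Let_def by blast
  then have "(mdist M p (c (t * D)))\<^sup>2 \<le> (dist ?q z)\<^sup>2"
    by (simp add: mdist_commute power_mono)
  then show ?thesis
    unfolding dist_convex_combination_sq using xyz D' by (simp add: dist_commute mdist_commute)
qed

text \<open>Isometric embeddings of convex sets map Euclidean segments to geodesics, so the inequality
  holds along flats as well; this is the form in which the CAT(0) condition acts on \<open>\<gamma>\<close>.\<close>

lemma CAT0_sq_dist_strongly_convex:
  fixes f :: "'b::real_normed_vector \<Rightarrow> 'a"
  assumes M: "CAT0_space M" and f: "isometric_embedding_on E M f" and E: "convex E" "x \<in> E" "y \<in> E"
    and p: "p \<in> mspace M" and t: "0 \<le> t" "t \<le> 1"
  shows "(mdist M p (f ((1 - t) *\<^sub>R x + t *\<^sub>R y)))\<^sup>2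
    \<le> (1 - t) * (mdist M p (f x))\<^sup>2 + t * (mdist M p (f y))\<^sup>2 - t * (1 - t) * (dist x y)\<^sup>2"
proof (cases "x = y")
  case True
  then show ?thesis by (simp add: algebra_simps)
next
  case False
  define D where "D = dist x y"
  have D: "D > 0" using False by (simp add: D_def)
  define c where "c s = f ((1 - s / D) *\<^sub>R x + (s / D) *\<^sub>R y)" for s
  have "isometric_embedding_on {0..D} M c"
    unfolding isometric_embedding_on_def
  proof (intro conjI ballI)
    have E': "(1 - s / D) *\<^sub>R x + (s / D) *\<^sub>R y \<in> E" if "s \<in> {0..D}" for s
      using E that D by (intro convexD) auto
    then show "c ` {0..D} \<subseteq> mspace M"
      using f unfolding isometric_embedding_on_def c_def by blast
    fix s u assume s: "s \<in> {0..D}" "u \<in> {0..D}"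
    have "mdist M (c s) (c u)
        = dist ((1 - s / D) *\<^sub>R x + (s / D) *\<^sub>R y) ((1 - u / D) *\<^sub>R x + (u / D) *\<^sub>R y)"
      using f E' s unfolding isometric_embedding_on_def c_def by blast
    also have "\<dots> = norm (((u - s) / D) *\<^sub>R (x - y))"
      unfolding dist_norm by (rule arg_cong[where f = norm]) (simp add: algebra_simps diff_divide_distrib)
    also have "\<dots> = dist s u"
      using D by (simp add: dist_norm[symmetric] D_def[symmetric] dist_real_def abs_minus_commute)
    finally show "mdist M (c s) (c u) = dist s u" .
  qed
  from CAT0_geodesic_sq_convex[OF M this p _ t] D show ?thesis
    by (simp add: c_def D_def[symmetric])
qed

text \<open>The right-hand side is the squared Euclidean distance between the corresponding points on two
  sides, of lengths \<open>L\<close> and \<open>L'\<close>, of the comparison triangle. It is written so that the limit for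
  \<open>L, L' \<longlongrightarrow> \<infinity>\<close> and \<open>L - L' \<longlongrightarrow> 0\<close> can be read off. The inequality follows by applying Stewart's
  inequality twice, to the whole triangle and to the one that the point \<open>c a\<close> cuts off; both are equations in the Euclidean plane, so nothing is lost.\<close>

lemma CAT0_dist_between_legs:
  assumes M: "CAT0_space M"
    and c: "isometric_embedding_on {0..L} M c" and e: "isometric_embedding_on {0..L'} M e"
    and apex: "c L = e L'" and a: "0 \<le> a" "a \<le> L" "0 < L" and b: "0 \<le> b" "b \<le> L'" "0 < L'"
  shows "(mdist M (c a) (e b))\<^sup>2
    \<le> (L - L' - a + b)\<^sup>2 + (1 - a / L) * (1 - b / L') * ((mdist M (c 0) (e 0))\<^sup>2 - (L - L')\<^sup>2)"
proof -
  define s t where "s = a / L" and "t = b / L'"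
  have st: "0 \<le> s" "s \<le> 1" "0 \<le> t" "t \<le> 1" and ab: "a = s * L" "b = t * L'"
    using a b by (auto simp: s_def t_def)
  have m: "c a \<in> mspace M" "e 0 \<in> mspace M"
    using c e a b unfolding isometric_embedding_on_def by auto
  have 1: "mdist M (c a) (e L') = (1 - s) * L"
  proof -
    have "mdist M (c a) (c L) = dist a L"
      using c a unfolding isometric_embedding_on_def by simp
    then show ?thesis using apex a by (simp add: dist_real_def ab algebra_simps)
  qed
  have 2: "mdist M (e 0) (c L) = L'"
  proof -
    have "mdist M (e 0) (e L') = dist 0 L'"
      using e b unfolding isometric_embedding_on_def by simp
    then show ?thesis using apex b by simp
  qed
  have 3: "(mdist M (c a) (e b))\<^sup>2 \<le> (1 - t) * (mdist M (c a) (e 0))\<^sup>2 + t * ((1 - s) * L)\<^sup>2 - t * (1 - t) * L'\<^sup>2"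
    using CAT0_geodesic_sq_convex[OF M e m(1) _ st(3,4)] b unfolding 1 by (simp add: ab)
  have 4: "(mdist M (c a) (e 0))\<^sup>2
      \<le> (1 - s) * (mdist M (c 0) (e 0))\<^sup>2 + s * L'\<^sup>2 - s * (1 - s) * L\<^sup>2"
    using CAT0_geodesic_sq_convex[OF M c m(2) _ st(1,2)] a unfolding 2 by (simp add: ab mdist_commute)
  have "(1 - t) * (mdist M (c a) (e 0))\<^sup>2
      \<le> (1 - t) * ((1 - s) * (mdist M (c 0) (e 0))\<^sup>2 + s * L'\<^sup>2 - s * (1 - s) * L\<^sup>2)"
    using 4 st by (intro mult_left_mono) auto
  with 3 have "(mdist M (c a) (e b))\<^sup>2
      \<le> (1 - t) * ((1 - s) * (mdist M (c 0) (e 0))\<^sup>2 + s * L'\<^sup>2 - s * (1 - s) * L\<^sup>2)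
        + t * ((1 - s) * L)\<^sup>2 - t * (1 - t) * L'\<^sup>2" by linarith
  also have "\<dots> = (L - L' - a + b)\<^sup>2 + (1 - s) * (1 - t) * ((mdist M (c 0) (e 0))\<^sup>2 - (L - L')\<^sup>2)"
    unfolding ab by (simp add: power2_eq_square algebra_simps)
  finally show ?thesis by (simp add: s_def t_def)
qed

section \<open>Ultralimits of points\<close>

text \<open>In this form the fact rewrites the term \<open>mdist M x x\<close> itself.\<close>

lemma mdist_self: "x \<in> mspace M \<Longrightarrow> mdist M x x = 0"
  by simp

lemma tendsto_mdist:
  assumes X: "\<And>j. x j \<in> mspace M" "x' \<in> mspace M" and Y: "\<And>j. y j \<in> mspace M" "y' \<in> mspace M"
    and lim: "((\<lambda>j. mdist M (x j) x') \<longlongrightarrow> 0) F" "((\<lambda>j. mdist M (y j) y') \<longlongrightarrow> 0) F"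
  shows "((\<lambda>j. mdist M (x j) (y j)) \<longlongrightarrow> mdist M x' y') F"
proof -
  have "((\<lambda>j. mdist M (x j) x' + mdist M (y j) y') \<longlongrightarrow> 0) F"
    using tendsto_add[OF lim] by simp
  moreover have "\<bar>mdist M (x j) (y j) - mdist M x' y'\<bar> \<le> mdist M (x j) x' + mdist M (y j) y'" for j
    using mdist_triangle[of "x j" M x' "y j"] mdist_triangle[of x' M y' "y j"]
      mdist_triangle[of x' M "x j" y'] mdist_triangle[of "x j" M "y j" y'] X Y
    by (simp add: mdist_commute)
  ultimately have "((\<lambda>j. mdist M (x j) (y j) - mdist M x' y') \<longlongrightarrow> 0) F"
    by (intro Lim_null_comparison[where f = "\<lambda>j. mdist M (x j) (y j) - mdist M x' y'"
          and g = "\<lambda>j. mdist M (x j) x' + mdist M (y j) y'"]) auto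
  then show ?thesis by (rule LIM_zero_cancel)
qed

text \<open>If no point were a limit, every point would have a ball that \<open>x j\<close> avoids for \<open>\<omega>\<close>-almost
  all \<open>j\<close>; finitely many of these balls cover \<open>K\<close>.\<close>

lemma compact_ultralimit_exists:
  assumes ul: "nonprincipal_ultrafilter \<omega>" and K: "compactin (mtopology_of M) K"
    and x: "eventually (\<lambda>j. x j \<in> K) \<omega>"
  shows "\<exists>z\<in>mspace M. ((\<lambda>j. mdist M (x j) z) \<longlongrightarrow> 0) \<omega>"
proof (rule ccontr)
  assume "\<not> ?thesis"
  then have "\<exists>r>0. \<not> eventually (\<lambda>j. mdist M (x j) z < r) \<omega>" if "z \<in> mspace M" for z
    using that by (auto simp: tendsto_iff)
  then obtain r where r: "\<And>z. z \<in> mspace M \<Longrightarrow> r z > 0"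
    "\<And>z. z \<in> mspace M \<Longrightarrow> \<not> eventually (\<lambda>j. mdist M (x j) z < r z) \<omega>"
    by metis
  have KM: "K \<subseteq> mspace M" using compactin_subset_topspace[OF K] by simp
  let ?B = "\<lambda>z. mball_of M z (r z)"
  have "\<forall>U\<in>?B ` K. openin (mtopology_of M) U"
    by (auto simp: mball_of_def mtopology_of_def Metric_space.openin_mball[OF Metric_space_mspace_mdist])
  moreover have "K \<subseteq> \<Union> (?B ` K)"
  proof
    fix z assume "z \<in> K"
    moreover from this have "z \<in> ?B z"
      using KM r(1)[of z] by (auto simp: in_mball_of mdist_self)
    ultimately show "z \<in> \<Union> (?B ` K)" by blast
  qed
  ultimately obtain \<F> where F: "finite \<F>" "\<F> \<subseteq> ?B ` K" "K \<subseteq> \<Union> \<F>"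
    using K unfolding compactin_def by meson
  then obtain Z where Z: "finite Z" "Z \<subseteq> K" "\<F> = ?B ` Z"
    by (meson finite_subset_image)
  have "eventually (\<lambda>j. \<forall>z\<in>Z. \<not> mdist M (x j) z < r z) \<omega>"
    using r(2) ul Z KM unfolding nonprincipal_ultrafilter_def
    by (intro eventually_ball_finite) auto
  then have "eventually (\<lambda>_. False) \<omega>"
    using x
  proof eventually_elim
    case (elim j)
    then show False using F(3) Z KM by (auto simp: in_mball_of mdist_commute)
  qed
  then show False using ul by (simp add: nonprincipal_ultrafilter_def trivial_limit_def)
qed

text \<open>This takes the place of the Hopf-Rinow theorem. The set of times at which the limit exists contains 0;
  it is open because \<open>M\<close> is locally compact and the paths move with speed at most 1, and closed
  because the limits that exist form a 1-Lipschitz family and \<open>M\<close> is complete. Hence it is the whole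
  connected half-line.\<close>

lemma Lipschitz_paths_ultralimit_exists:
  assumes complete: "mcomplete_of M" and lc: "locally_compact_space (mtopology_of M)"
    and ul: "nonprincipal_ultrafilter \<omega>"
    and e: "\<And>j a. 0 \<le> a \<Longrightarrow> e j a \<in> mspace M"
    and lip: "\<And>j a b. 0 \<le> a \<Longrightarrow> 0 \<le> b \<Longrightarrow> mdist M (e j a) (e j b) \<le> \<bar>a - b\<bar>"
    and start: "\<And>j. e j 0 = x" and "0 \<le> a"
  shows "\<exists>z\<in>mspace M. ((\<lambda>j. mdist M (e j a) z) \<longlongrightarrow> 0) \<omega>"
proof -
  have nb: "\<omega> \<noteq> bot" using ul by (simp add: nonprincipal_ultrafilter_def)
  define C where "C = {a\<in>{0..}. \<exists>z\<in>mspace M. ((\<lambda>j. mdist M (e j a) z) \<longlongrightarrow> 0) \<omega>}"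
  have x: "x \<in> mspace M" using e[of 0] start by auto
  then have "0 \<in> C"
    using start by (auto simp: C_def mdist_self intro!: bexI[of _ x])
  moreover have "openin (top_of_set {0..}) C"
    unfolding openin_euclidean_subtopology_iff
  proof (intro conjI ballI)
    show "C \<subseteq> {0..}" by (auto simp: C_def)
    fix a assume "a \<in> C"
    then obtain z where z: "0 \<le> a" "z \<in> mspace M" "((\<lambda>j. mdist M (e j a) z) \<longlongrightarrow> 0) \<omega>"
      by (auto simp: C_def)
    obtain U K where UK: "openin (mtopology_of M) U" "compactin (mtopology_of M) K" "z \<in> U" "U \<subseteq> K"
      using lc z(2) unfolding locally_compact_space_def by auto
    obtain r where r: "r > 0" "mball_of M z r \<subseteq> U"
      using UK(1,3) by (auto simp: mtopology_of_def mball_of_def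
          Metric_space.openin_mtopology[OF Metric_space_mspace_mdist])
    show "\<exists>\<epsilon>>0. \<forall>b\<in>{0..}. dist b a < \<epsilon> \<longrightarrow> b \<in> C"
    proof (intro exI[of _ "r / 2"] conjI ballI impI)
      fix b :: real assume b: "b \<in> {0..}" "dist b a < r / 2"
      have "eventually (\<lambda>j. mdist M (e j a) z < r / 2) \<omega>"
        using z(3) r(1) by (intro order_tendstoD(2)) auto
      then have "eventually (\<lambda>j. e j b \<in> K) \<omega>"
      proof eventually_elim
        case (elim j)
        have "mdist M z (e j b) \<le> mdist M z (e j a) + mdist M (e j a) (e j b)"
          using e z b by (intro mdist_triangle) auto
        also have "\<dots> < r"
          using elim lip[of a b j] z b by (simp add: mdist_commute dist_real_def abs_minus_commute)
        finally have "e j b \<in> mball_of M z r" using e z b by (simp add: in_mball_of)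
        then show ?case using r UK by blast
      qed
      from compact_ultralimit_exists[OF ul UK(2) this] show "b \<in> C" using b by (simp add: C_def)
    qed (use r in simp)
  qed
  moreover have "closedin (top_of_set {0..}) C"
    unfolding closedin_limpt
  proof (intro conjI allI impI)
    show "C \<subseteq> {0..}" by (auto simp: C_def)
    fix a assume "a islimpt C \<and> a \<in> {0..}"
    then obtain s where s: "\<And>n. s n \<in> C" "s \<longlonglongrightarrow> a" and a: "0 \<le> a"
      unfolding islimpt_sequential by auto
    then have "\<forall>n. \<exists>z. z \<in> mspace M \<and> ((\<lambda>j. mdist M (e j (s n)) z) \<longlongrightarrow> 0) \<omega>" and s0: "\<And>n. 0 \<le> s n"
      by (auto simp: C_def Bex_def)
    then obtain z where z: "\<And>n. z n \<in> mspace M" "\<And>n. ((\<lambda>j. mdist M (e j (s n)) (z n)) \<longlongrightarrow> 0) \<omega>"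
      by metis
    have zd: "mdist M (z m) (z n) \<le> \<bar>s m - s n\<bar>" for m n
    proof (rule tendsto_upperbound[OF _ _ nb])
      show "((\<lambda>j. mdist M (e j (s m)) (e j (s n))) \<longlongrightarrow> mdist M (z m) (z n)) \<omega>"
        using e s0 z by (intro tendsto_mdist) auto
    qed (use lip s0 in auto)
    interpret Ms: Metric_space "mspace M" "mdist M" by (rule Metric_space_mspace_mdist)
    have "Ms.MCauchy z"
      unfolding Ms.MCauchy_def
    proof (intro conjI allI impI)
      show "range z \<subseteq> mspace M" using z by auto
      fix \<epsilon> :: real assume "\<epsilon> > 0"
      then obtain N where "\<And>m n. m \<ge> N \<Longrightarrow> n \<ge> N \<Longrightarrow> dist (s m) (s n) < \<epsilon>"
        using LIMSEQ_imp_Cauchy[OF s(2)] unfolding Cauchy_def by blast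
      then show "\<exists>N. \<forall>n n'. N \<le> n \<longrightarrow> N \<le> n' \<longrightarrow> mdist M (z n) (z n') < \<epsilon>"
        using zd by (metis dist_real_def le_less_trans)
    qed
    then obtain w where "limitin Ms.mtopology z w sequentially"
      using complete unfolding mcomplete_of_def Ms.mcomplete_def by blast
    then have w: "w \<in> mspace M" "(\<lambda>n. mdist M (z n) w) \<longlonglongrightarrow> 0"
      unfolding Ms.limit_metric_sequentially by (auto simp: LIMSEQ_iff) metis
    have "((\<lambda>j. mdist M (e j a) w) \<longlongrightarrow> 0) \<omega>"
    proof (rule tendstoI)
      fix \<epsilon> :: real assume \<epsilon>: "\<epsilon> > 0"
      have "eventually (\<lambda>n. mdist M (z n) w < \<epsilon> / 3) sequentially"
        using w(2) \<epsilon> by (intro order_tendstoD(2)) auto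
      moreover have "eventually (\<lambda>n. dist (s n) a < \<epsilon> / 3) sequentially"
        using s(2) \<epsilon> by (intro tendstoD) auto
      ultimately have "eventually (\<lambda>n. mdist M (z n) w < \<epsilon> / 3 \<and> dist (s n) a < \<epsilon> / 3) sequentially"
        by (rule eventually_conj)
      then obtain n where n: "mdist M (z n) w < \<epsilon> / 3" "dist (s n) a < \<epsilon> / 3"
        using eventually_happens'[OF sequentially_bot] by blast
      have "eventually (\<lambda>j. mdist M (e j (s n)) (z n) < \<epsilon> / 3) \<omega>"
        using z(2) \<epsilon> by (intro order_tendstoD(2)) auto
      then show "eventually (\<lambda>j. dist (mdist M (e j a) w) 0 < \<epsilon>) \<omega>"
      proof eventually_elim
        case (elim j)
        have "mdist M (e j a) w \<le> mdist M (e j a) (e j (s n)) + mdist M (e j (s n)) w"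
          using e a s0 w by (intro mdist_triangle) auto
        moreover have "mdist M (e j (s n)) w \<le> mdist M (e j (s n)) (z n) + mdist M (z n) w"
          using e a s0 w z by (intro mdist_triangle) auto
        moreover have "mdist M (e j a) (e j (s n)) \<le> \<bar>a - s n\<bar>" using lip a s0 by blast
        ultimately show ?case using elim n by (simp add: dist_real_def abs_minus_commute)
      qed
    qed
    then show "a \<in> C" using a w by (auto simp: C_def)
  qed
  ultimately have "C = {0..}"
    using connected_clopen[of "{0::real..}"] convex_connected[of "{0::real..}"] by auto
  then show ?thesis using \<open>0 \<le> a\<close> unfolding C_def by auto
qed


section \<open>Half-flats from points receding orthogonally to a flat\<close>

text \<open>The equidistance hypothesis says that a Busemann function centred at a limit of the \<open>p j\<close> is
  constant on the flat. In a Euclidean half-space, with the \<open>p j\<close> going to infinity in the normal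
  direction, the construction below returns the half-space itself.\<close>

lemma half_flat_from_receding_points:
  fixes f :: "'b::real_normed_vector \<Rightarrow> 'a"
  assumes complete: "mcomplete_of M" and lc: "locally_compact_space (mtopology_of M)"
    and M: "CAT0_space M" and ul: "nonprincipal_ultrafilter \<omega>"
    and f: "isometric_embedding_on UNIV M f" and p: "\<And>j. p j \<in> mspace M"
    and far: "\<And>x. filterlim (\<lambda>j. mdist M (p j) (f x)) at_top \<omega>"
    and equidistant: "\<And>x y. ((\<lambda>j. mdist M (p j) (f x) - mdist M (p j) (f y)) \<longlongrightarrow> 0) \<omega>"
  shows "\<exists>h. isometric_embedding_on (UNIV \<times> {0..}) M h \<and> (\<forall>x. h (x, 0::real) = f x)"
proof -
  have nb: "\<omega> \<noteq> bot" using ul by (simp add: nonprincipal_ultrafilter_def)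
  define L where "L x j = mdist M (p j) (f x)" for x j
  have L0: "0 \<le> L x j" for x j by (simp add: L_def)
  have fM: "f x \<in> mspace M" and fd: "mdist M (f x) (f y) = dist x y" for x y
    using f unfolding isometric_embedding_on_def by auto
  have "\<forall>x j. \<exists>c. isometric_embedding_on {0..L x j} M c \<and> c 0 = f x \<and> c (L x j) = p j"
    using M fM p unfolding CAT0_space_def geodesic_space_def geodesic_segment_def L_def
    by (metis mdist_commute)
  then obtain c where c: "\<And>x j. isometric_embedding_on {0..L x j} M (c x j)"
    "\<And>x j. c x j 0 = f x" "\<And>x j. c x j (L x j) = p j"
    by metis
  \<comment> \<open>Stopping the geodesics at \<open>p j\<close> makes them 1-Lipschitz paths on the whole half-line.\<close>
  define e where "e x j a = c x j (min a (L x j))" for x j a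
  have eM: "e x j a \<in> mspace M" if "0 \<le> a" for x j a
    using c(1)[of x j] that L0[of x j] unfolding isometric_embedding_on_def e_def by auto
  have lip: "mdist M (e x j a) (e x j b) \<le> \<bar>a - b\<bar>" if "0 \<le> a" "0 \<le> b" for x j a b
  proof -
    have "mdist M (e x j a) (e x j b) = dist (min a (L x j)) (min b (L x j))"
      using c(1)[of x j] that L0[of x j] unfolding isometric_embedding_on_def e_def by auto
    then show ?thesis by (simp add: dist_real_def min_def)
  qed
  have e0: "e x j 0 = f x" for x j using c(2) L0[of x j] by (simp add: e_def)
  have "\<exists>z\<in>mspace M. ((\<lambda>j. mdist M (e x j a) z) \<longlongrightarrow> 0) \<omega>" if "0 \<le> a" for x a
    by (rule Lipschitz_paths_ultralimit_exists[where e = "e x", OF complete lc ul eM lip e0 that])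
  then have "\<forall>x a. \<exists>z. 0 \<le> a \<longrightarrow> z \<in> mspace M \<and> ((\<lambda>j. mdist M (e x j a) z) \<longlongrightarrow> 0) \<omega>"
    by blast
  then obtain H where HM: "\<And>x a. 0 \<le> a \<Longrightarrow> H x a \<in> mspace M"
    and H: "\<And>x a. 0 \<le> a \<Longrightarrow> ((\<lambda>j. mdist M (e x j a) (H x a)) \<longlongrightarrow> 0) \<omega>"
    by metis
  have Hlim: "((\<lambda>j. mdist M (e x j a) (e y j b)) \<longlongrightarrow> mdist M (H x a) (H y b)) \<omega>"
    if "0 \<le> a" "0 \<le> b" for x y a b
    using that by (intro tendsto_mdist eM HM H)
  have H0: "H x 0 = f x" for x
  proof -
    have "mdist M (f x) (H x 0) = 0"
      using H[of 0 x] nb by (simp add: e0 tendsto_const_iff)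
    then show ?thesis using mdist_zero[OF fM HM[of 0 x]] by simp
  qed
  have far': "eventually (\<lambda>j. a < L x j) \<omega>" for a x
    using far unfolding L_def filterlim_at_top_dense by blast
  have height: "mdist M (H x a) (f x) = a" if "0 \<le> a" for x a
  proof (rule tendsto_unique[OF nb])
    show "((\<lambda>j. mdist M (e x j a) (e x j 0)) \<longlongrightarrow> mdist M (H x a) (f x)) \<omega>"
      using Hlim[of a 0 x x] that by (simp add: H0)
    have "eventually (\<lambda>j. mdist M (e x j a) (e x j 0) = a) \<omega>"
      using far'[of a x]
    proof eventually_elim
      case (elim j)
      have "mdist M (c x j a) (c x j 0) = dist a 0"
        using c(1)[of x j] that elim unfolding isometric_embedding_on_def by auto
      then show ?case using that elim by (simp add: e_def)
    qed
    then show "((\<lambda>j. mdist M (e x j a) (e x j 0)) \<longlongrightarrow> a) \<omega>"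
      by (rule tendsto_eventually)
  qed
  have upper: "(mdist M (H x a) (H y b))\<^sup>2 \<le> (dist x y)\<^sup>2 + (a - b)\<^sup>2"
    if ab: "0 \<le> a" "0 \<le> b" for x y a b
  proof -
    let ?R = "\<lambda>j. (L x j - L y j - a + b)\<^sup>2 + (1 - a / L x j) * (1 - b / L y j) * ((dist x y)\<^sup>2 - (L x j - L y j)\<^sup>2)"
    have quot: "((\<lambda>j. s / L z j) \<longlongrightarrow> 0) \<omega>" for s z
      using far[of z] unfolding L_def by (rule real_tendsto_divide_at_top[OF tendsto_const])
    have "(?R \<longlongrightarrow> (0 - a + b)\<^sup>2 + (1 - 0) * (1 - 0) * ((dist x y)\<^sup>2 - 0\<^sup>2)) \<omega>"
      using equidistant[of x y] unfolding L_def[symmetric]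
      by (intro tendsto_intros quot) auto
    moreover have "((\<lambda>j. (mdist M (e x j a) (e y j b))\<^sup>2) \<longlongrightarrow> (mdist M (H x a) (H y b))\<^sup>2) \<omega>"
      using ab by (intro tendsto_power Hlim)
    moreover have "eventually (\<lambda>j. (mdist M (e x j a) (e y j b))\<^sup>2 \<le> ?R j) \<omega>"
      using far'[of a x] far'[of b y]
    proof eventually_elim
      case (elim j)
      then show ?case
        using CAT0_dist_between_legs[OF M c(1)[of x j] c(1)[of y j], of a b] ab
        by (simp add: c(2,3) fd e_def)
    qed
    ultimately have "(mdist M (H x a) (H y b))\<^sup>2 \<le> (0 - a + b)\<^sup>2 + (1 - 0) * (1 - 0) * ((dist x y)\<^sup>2 - 0\<^sup>2)"
      using tendsto_le[OF nb] by blast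
    then show ?thesis by (simp add: power2_commute)
  qed
  \<comment> \<open>Strong convexity at the midpoint \<open>f x\<close> of \<open>f y\<close> and its mirror image \<open>f ?y\<close>: the distance from
    \<open>H x a\<close> is exact at \<open>f x\<close> and at most Euclidean at \<open>f ?y\<close>, so it is at least Euclidean at \<open>f y\<close>.\<close>
  have foot: "(dist x y)\<^sup>2 + a\<^sup>2 \<le> (mdist M (H x a) (f y))\<^sup>2" if a: "0 \<le> a" for x y a
  proof -
    let ?y = "2 *\<^sub>R x - y"
    have "(1 - 1/2) *\<^sub>R y + (1/2) *\<^sub>R ?y = x"
      by (simp add: algebra_simps)
    then have "a\<^sup>2 \<le> (mdist M (H x a) (f y))\<^sup>2 / 2 + (mdist M (H x a) (f ?y))\<^sup>2 / 2 - (dist y ?y)\<^sup>2 / 4"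
      using CAT0_sq_dist_strongly_convex[OF M f _ _ _ HM[OF a], of y ?y "1/2" x] height[OF a, of x] by simp
    moreover have "y - ?y = 2 *\<^sub>R (y - x)" by (simp add: algebra_simps scaleR_2)
    then have "dist y ?y = 2 * dist x y" by (simp add: dist_norm norm_minus_commute)
    moreover have xy: "x - ?y = y - x" by (simp add: algebra_simps scaleR_2)
    have "dist x ?y = dist x y" unfolding dist_norm xy by (rule norm_minus_commute)
    then have "(mdist M (H x a) (f ?y))\<^sup>2 \<le> (dist x y)\<^sup>2 + a\<^sup>2"
      using upper[OF a, of 0 x ?y] by (simp add: H0)
    ultimately show ?thesis by (simp add: power_mult_distrib)
  qed
  have lower_less: "sqrt ((dist x y)\<^sup>2 + (a - b)\<^sup>2) \<le> mdist M (H x a) (H y b)"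
    if ab: "0 \<le> b" "b < a" for x y a b
  proof -
    \<comment> \<open>The Euclidean line from \<open>(x, a)\<close> through \<open>(y, b)\<close> meets the boundary at \<open>(v, 0)\<close>. The whole
      segment has at least its Euclidean length and the part beyond \<open>(y, b)\<close> at most its own.\<close>
    define k where "k = b / (a - b)"
    define v where "v = y + k *\<^sub>R (y - x)"
    have k: "0 \<le> k" "b = k * (a - b)" using ab by (auto simp: k_def)
    have ka: "a = (1 + k) * (a - b)" using k(2) by (simp add: algebra_simps)
    have "v - y = k *\<^sub>R (y - x)" "v - x = (1 + k) *\<^sub>R (y - x)" by (simp_all add: v_def algebra_simps)
    then have vd: "dist y v = k * dist x y" "dist x v = (1 + k) * dist x y"
      using k(1) by (simp_all add: dist_norm norm_minus_commute[of y v] norm_minus_commute[of x v]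
          norm_minus_commute[of x y])
    let ?E = "sqrt ((dist x y)\<^sup>2 + (a - b)\<^sup>2)"
    have scale: "(s * dist x y)\<^sup>2 + (s * (a - b))\<^sup>2 = (s * ?E)\<^sup>2" for s
      by (simp add: power_mult_distrib distrib_left)
    have "((1 + k) * ?E)\<^sup>2 \<le> (mdist M (H x a) (f v))\<^sup>2"
      using foot[of a x v] ab vd(2) ka scale[of "1 + k"] by simp
    then have 1: "(1 + k) * ?E \<le> mdist M (H x a) (f v)"
      by (rule power2_le_imp_le) simp
    have "(mdist M (H y b) (f v))\<^sup>2 \<le> (k * ?E)\<^sup>2"
      using upper[of b 0 y v] ab vd(1) k(2) scale[of k] by (simp add: H0)
    then have 2: "mdist M (H y b) (f v) \<le> k * ?E"
      by (rule power2_le_imp_le) (use k in simp)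
    have "mdist M (H x a) (f v) \<le> mdist M (H x a) (H y b) + mdist M (H y b) (f v)"
      using ab by (intro mdist_triangle HM fM) auto
    with 1 2 show ?thesis by (simp add: algebra_simps)
  qed
  \<comment> \<open>A segment parallel to the boundary is a limit of tilted ones, which do meet the boundary when
    extended.\<close>
  have lower_eq: "dist x y \<le> mdist M (H x a) (H y a)" if a: "0 \<le> a" for x y a
  proof (rule field_le_epsilon)
    fix \<epsilon> :: real assume \<epsilon>: "0 < \<epsilon>"
    have "dist x y \<le> sqrt ((dist x y)\<^sup>2 + (a + \<epsilon> - a)\<^sup>2)"
      by (rule real_le_rsqrt) simp
    also have "\<dots> \<le> mdist M (H x (a + \<epsilon>)) (H y a)" using lower_less[of a "a + \<epsilon>" x y] a \<epsilon> by simp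
    also have "\<dots> \<le> mdist M (H x (a + \<epsilon>)) (H x a) + mdist M (H x a) (H y a)"
      using a \<epsilon> by (intro mdist_triangle HM) auto
    also have "(mdist M (H x (a + \<epsilon>)) (H x a))\<^sup>2 \<le> \<epsilon>\<^sup>2"
      using upper[of "a + \<epsilon>" a x x] a \<epsilon> by simp
    then have "mdist M (H x (a + \<epsilon>)) (H x a) \<le> \<epsilon>"
      by (rule power2_le_imp_le) (use \<epsilon> in simp)
    finally show "dist x y \<le> mdist M (H x a) (H y a) + \<epsilon>" by simp
  qed
  have lower: "sqrt ((dist x y)\<^sup>2 + (a - b)\<^sup>2) \<le> mdist M (H x a) (H y b)"
    if "0 \<le> a" "0 \<le> b" for x y a b
    using lower_less[of b a x y] lower_less[of a b y x] lower_eq[of a x y] that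
    by (cases a b rule: linorder_cases) (auto simp: dist_commute mdist_commute power2_commute)
  have "mdist M (H x a) (H y b) = dist (x, a) (y, b)" if "0 \<le> a" "0 \<le> b" for x y a b
    using lower[OF that] real_le_rsqrt[OF upper[OF that]]
    by (simp add: dist_Pair_Pair dist_real_def antisym)
  then have "isometric_embedding_on (UNIV \<times> {0..}) M (\<lambda>(x, a). H x a)"
    using HM by (auto simp: isometric_embedding_on_def)
  then show ?thesis using H0 by (intro exI[of _ "\<lambda>(x, a). H x a"]) simp
qed

section \<open>Receding points from the asymptotic cone\<close>

text \<open>Write \<open>\<phi>(x) = d(p\<^sub>j, f x)\<^sup>2\<close>. The point \<open>x\<close> divides the segment from \<open>0\<close> to \<open>\<lambda>\<^sub>j x\<close> in the ratio
  given by \<open>t = 1 / \<lambda>\<^sub>j\<close>, and \<open>\<phi>(\<lambda>\<^sub>j x) - \<phi>(0) = \<lambda>\<^sub>j\<^sup>2 (|x|\<^sup>2 + o(1))\<close>. The strong convexity of \<open>\<phi>\<close>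
  therefore gives \<open>\<phi>(x) - \<phi>(0) \<le> o(\<lambda>\<^sub>j)\<close>: the term \<open>\<lambda>\<^sub>j |x|\<^sup>2\<close> cancels. The same estimate at
  \<open>- x\<close> and convexity at the midpoint \<open>0\<close> give the opposite bound.\<close>

lemma receding_points_equidistant:
  fixes f :: "'b::real_normed_vector \<Rightarrow> 'a"
  assumes M: "CAT0_space M" and nb: "\<omega> \<noteq> bot" and f: "isometric_embedding_on UNIV M f" and p: "\<And>j. p j \<in> mspace M"
    and lam: "\<And>j. 0 < lam j" and lamtop: "filterlim lam at_top \<omega>"
    and lim: "\<And>x. ((\<lambda>j. mdist M (p j) (f (lam j *\<^sub>R x)) / lam j) \<longlongrightarrow> sqrt (1 + (norm x)\<^sup>2)) \<omega>"
  shows "filterlim (\<lambda>j. mdist M (p j) (f x)) at_top \<omega>"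
    and "((\<lambda>j. mdist M (p j) (f x) - mdist M (p j) (f y)) \<longlongrightarrow> 0) \<omega>"
proof -
  define g where "g x j = mdist M (p j) (f x)" for x j
  define q where "q x j = ((g x j)\<^sup>2 - (g 0 j)\<^sup>2) / lam j" for x j
  \<comment> \<open>\<open>u x\<close> is the bound for \<open>q x\<close> that strong convexity gives with \<open>t = 1 / lam j\<close>.\<close>
  define u where "u x j = (g (lam j *\<^sub>R x) j / lam j)\<^sup>2 - (g 0 j / lam j)\<^sup>2 - (1 - 1 / lam j) * (norm x)\<^sup>2" for x j
  have lim0: "((\<lambda>j. g 0 j / lam j) \<longlongrightarrow> 1) \<omega>"
    using lim[of 0] by (simp add: g_def)
  have inv0: "((\<lambda>j. 1 / lam j) \<longlongrightarrow> 0) \<omega>"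
    by (rule real_tendsto_divide_at_top[OF tendsto_const lamtop])
  have u0: "(u x \<longlongrightarrow> 0) \<omega>" for x
  proof -
    have "(u x \<longlongrightarrow> (sqrt (1 + (norm x)\<^sup>2))\<^sup>2 - 1\<^sup>2 - (1 - 0) * (norm x)\<^sup>2) \<omega>"
      unfolding u_def
      by (intro tendsto_intros lim0 inv0 lim[folded g_def])
    then show ?thesis by simp
  qed
  have qu: "eventually (\<lambda>j. q x j \<le> u x j) \<omega>" for x
    using lamtop[unfolded filterlim_at_top, rule_format, of 1]
  proof eventually_elim
    case (elim j)
    have l: "lam j > 0" by (rule lam)
    have "(g x j)\<^sup>2 \<le> (1 - 1 / lam j) * (g 0 j)\<^sup>2 + (1 / lam j) * (g (lam j *\<^sub>R x) j)\<^sup>2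
        - (1 / lam j) * (1 - 1 / lam j) * (lam j * norm x)\<^sup>2"
      using CAT0_sq_dist_strongly_convex[OF M f _ _ _ p[of j], of 0 "lam j *\<^sub>R x" "1 / lam j"] elim l
      by (simp add: g_def)
    then have "q x j \<le> ((1 - 1 / lam j) * (g 0 j)\<^sup>2 + (1 / lam j) * (g (lam j *\<^sub>R x) j)\<^sup>2
        - (1 / lam j) * (1 - 1 / lam j) * (lam j * norm x)\<^sup>2 - (g 0 j)\<^sup>2) / lam j"
      unfolding q_def using l by (intro divide_right_mono) auto
    also have "\<dots> = u x j"
      unfolding u_def using l by (simp add: field_simps power2_eq_square)
    finally show ?case .
  qed
  have qq: "- q (- x) j \<le> q x j" for x j
  proof -
    have e: "(1 - 1/2) *\<^sub>R x + (1/2) *\<^sub>R (- x) = 0" by (simp add: algebra_simps)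
    have "(g 0 j)\<^sup>2 \<le> (g x j)\<^sup>2 / 2 + (g (- x) j)\<^sup>2 / 2 - (dist x (- x))\<^sup>2 / 4"
      using CAT0_sq_dist_strongly_convex[OF M f _ _ _ p[of j], of x "- x" "1/2", unfolded e]
      by (simp add: g_def)
    then have "0 \<le> ((g x j)\<^sup>2 - (g 0 j)\<^sup>2) + ((g (- x) j)\<^sup>2 - (g 0 j)\<^sup>2)"
      using zero_le_power2[of "dist x (- x)"] by linarith
    then have "0 \<le> q x j + q (- x) j"
      unfolding q_def add_divide_distrib[symmetric] using lam[of j] by simp
    then show ?thesis by simp
  qed
  have q0: "(q x \<longlongrightarrow> 0) \<omega>" for x
  proof (rule tendsto_sandwich[OF _ qu _ u0])
    show "eventually (\<lambda>j. - u (- x) j \<le> q x j) \<omega>"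
      using qu[of "- x"] by eventually_elim (use qq in \<open>meson neg_le_iff_le order_trans\<close>)
    show "((\<lambda>j. - u (- x) j) \<longlongrightarrow> 0) \<omega>" using tendsto_minus[OF u0[of "- x"]] by simp
  qed
  have one: "((\<lambda>j. g x j / lam j) \<longlongrightarrow> 1) \<omega>" for x
  proof -
    have "((\<lambda>j. sqrt ((g 0 j / lam j)\<^sup>2 + q x j * (1 / lam j))) \<longlongrightarrow> sqrt (1\<^sup>2 + 0 * 0)) \<omega>"
      by (intro tendsto_intros lim0 q0 inv0)
    moreover have "sqrt ((g 0 j / lam j)\<^sup>2 + q x j * (1 / lam j)) = g x j / lam j" for j
    proof -
      have "(g 0 j / lam j)\<^sup>2 + q x j * (1 / lam j) = (g x j / lam j)\<^sup>2"
        using lam[of j] by (simp add: q_def field_simps power2_eq_square)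
      moreover have "0 \<le> g x j / lam j" using lam[of j] by (simp add: g_def)
      ultimately show ?thesis by (simp only: real_sqrt_abs abs_of_nonneg)
    qed
    ultimately show ?thesis by simp
  qed
  have "filterlim (\<lambda>j. g x j / lam j * lam j) at_top \<omega>"
    by (rule filterlim_tendsto_pos_mult_at_top[OF one _ lamtop]) simp
  moreover have "g x j / lam j * lam j = g x j" for j using lam[of j] by simp
  ultimately show "filterlim (\<lambda>j. mdist M (p j) (f x)) at_top \<omega>" by (simp add: g_def)
  \<comment> \<open>A difference of squares divided by the sum, both scaled by \<open>lam j\<close>; the scaled sum tends to 2.\<close>
  have "((\<lambda>j. (q x j - q y j) / (g x j / lam j + g y j / lam j)) \<longlongrightarrow> (0 - 0) / (1 + 1)) \<omega>"
    by (intro tendsto_intros q0 one) auto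
  moreover have "eventually (\<lambda>j. (q x j - q y j) / (g x j / lam j + g y j / lam j) = g x j - g y j) \<omega>"
    using order_tendstoD(1)[OF one[of x] zero_less_one] order_tendstoD(1)[OF one[of y] zero_less_one]
  proof eventually_elim
    case (elim j)
    have "q x j - q y j = (g x j - g y j) * (g x j / lam j + g y j / lam j)"
      using lam[of j] by (simp add: q_def field_simps power2_eq_square)
    then show ?case using elim by simp
  qed
  ultimately show "((\<lambda>j. mdist M (p j) (f x) - mdist M (p j) (f y)) \<longlongrightarrow> 0) \<omega>"
    by (simp add: g_def tendsto_cong)
qed

lemma (in cone_data) mdist_asymptotic_cone_tendsto:
  assumes "A \<in> mspace (asymptotic_cone M b lam \<omega>)" "x \<in> A"
    and "B \<in> mspace (asymptotic_cone M b lam \<omega>)" "y \<in> B"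
  shows "((\<lambda>j. mdist M (x j) (y j) / lam j) \<longlongrightarrow> mdist (asymptotic_cone M b lam \<omega>) A B) \<omega>"
  using dist_omega_lim[of x y] mdist_asymptotic_cone[OF assms, symmetric] by simp

lemma (in cone_data) cone_class_exists:
  assumes x: "range x \<subseteq> mspace M" and lim: "((\<lambda>j. mdist M (x j) b / lam j) \<longlongrightarrow> l) \<omega>"
  shows "\<exists>A\<in>mspace (asymptotic_cone M b lam \<omega>). x \<in> A"
proof -
  have "dist_omega M lam \<omega> x (\<lambda>_. b) = ereal l"
    unfolding dist_omega_def using lim by (intro tendsto_Lim nb) simp
  then have "x \<in> cone_seqs M b lam \<omega>" using x by (simp add: cone_seqs_def)
  then show ?thesis
    unfolding mspace_asymptotic_cone
    by (intro bexI[of _ "cone_rel M b lam \<omega> `` {x}"] equiv_class_self[OF equiv_cone_rel] quotientI)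
qed

text \<open>The sequences \<open>f (lam j *\<^sub>R x)\<close> represent points of the limit flat at distance \<open>norm x\<close> from
  the class of the constant sequence \<open>f 0\<close>. The half-flat need not be parametrised compatibly with
  \<open>f\<close>, but only distances to the boundary point \<open>v 0\<close> of that class matter, so it is enough to know
  that \<open>x \<mapsto> v x\<close> preserves distances to it.\<close>

lemma (in cone_data) height_one_sequence:
  fixes f :: "real^'k::finite \<Rightarrow> 'a"
  assumes lamtop: "filterlim lam at_top \<omega>" and f: "isometric_embedding_on UNIV M f"
    and half: "bounds_half_flat TYPE('k) (asymptotic_cone M b lam \<omega>) (cone_limit M b lam \<omega> (range f))"
  obtains p where "\<And>j. p j \<in> mspace M"
    "\<And>x. ((\<lambda>j. mdist M (p j) (f (lam j *\<^sub>R x)) / lam j) \<longlongrightarrow> sqrt (1 + (norm x)\<^sup>2)) \<omega>"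
proof -
  let ?X = "asymptotic_cone M b lam \<omega>"
  have fM: "f x \<in> mspace M" and fd: "mdist M (f x) (f y) = dist x y" for x y
    using f unfolding isometric_embedding_on_def by auto
  obtain h :: "(real^'k) \<times> real \<Rightarrow> _" where h: "isometric_embedding_on (UNIV \<times> {0..}) ?X h"
    and h0: "h ` (UNIV \<times> {0}) = cone_limit M b lam \<omega> (range f)"
    using half unfolding bounds_half_flat_def by blast
  have hX: "h (v, s) \<in> mspace ?X"
    and hd: "0 \<le> t \<Longrightarrow> mdist ?X (h (v, s)) (h (w, t)) = dist (v, s) (w, t)"
    if "0 \<le> s" for v w s t
    using h that unfolding isometric_embedding_on_def by auto
  have "\<exists>v. (\<lambda>j. f (lam j *\<^sub>R x)) \<in> h (v, 0)" for x
  proof -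
    have "((\<lambda>j. mdist M (f 0) b / lam j) \<longlongrightarrow> 0) \<omega>"
      by (rule real_tendsto_divide_at_top[OF tendsto_const lamtop])
    moreover have "\<bar>mdist M (f (lam j *\<^sub>R x)) b / lam j - norm x\<bar> \<le> mdist M (f 0) b / lam j" for j
    proof -
      have "mdist M (f 0) (f (lam j *\<^sub>R x)) = lam j * norm x"
        using lam[of j] by (simp add: fd)
      then have "\<bar>mdist M (f (lam j *\<^sub>R x)) b - lam j * norm x\<bar> \<le> mdist M (f 0) b"
        using mdist_triangle[OF fM fM b, of "lam j *\<^sub>R x" 0] mdist_triangle[OF fM b fM, of 0 "lam j *\<^sub>R x"]
        by (simp add: mdist_commute abs_le_iff)
      moreover have "mdist M (f (lam j *\<^sub>R x)) b / lam j - norm x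
          = (mdist M (f (lam j *\<^sub>R x)) b - lam j * norm x) / lam j"
        using lam[of j] by (simp add: field_simps)
      ultimately show ?thesis using lam[of j] by (simp add: divide_right_mono)
    qed
    ultimately have "((\<lambda>j. mdist M (f (lam j *\<^sub>R x)) b / lam j - norm x) \<longlongrightarrow> 0) \<omega>"
      by (intro Lim_null_comparison[where f = "\<lambda>j. mdist M (f (lam j *\<^sub>R x)) b / lam j - norm x"]) auto
    then have "((\<lambda>j. mdist M (f (lam j *\<^sub>R x)) b / lam j) \<longlongrightarrow> norm x) \<omega>"
      by (rule LIM_zero_cancel)
    moreover have "range (\<lambda>j. f (lam j *\<^sub>R x)) \<subseteq> mspace M" using fM by auto
    ultimately obtain A where A: "A \<in> mspace ?X" "(\<lambda>j. f (lam j *\<^sub>R x)) \<in> A"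
      using cone_class_exists by metis
    have "range (\<lambda>j. f (lam j *\<^sub>R x)) \<subseteq> range f" by auto
    with A have "A \<in> cone_limit M b lam \<omega> (range f)"
      unfolding cone_limit_def by (intro CollectI conjI bexI)
    then obtain v where "A = h (v, 0)" unfolding h0[symmetric] by (elim imageE SigmaE) simp
    with A(2) show ?thesis by (intro exI[of _ v]) simp
  qed
  then obtain v where v: "\<And>x. (\<lambda>j. f (lam j *\<^sub>R x)) \<in> h (v x, 0)"
    by metis
  have vd: "dist (v 0) (v x) = norm x" for x
  proof (rule tendsto_unique[OF nb])
    show "((\<lambda>j. mdist M (f (lam j *\<^sub>R 0)) (f (lam j *\<^sub>R x)) / lam j) \<longlongrightarrow> dist (v 0) (v x)) \<omega>"
      using mdist_asymptotic_cone_tendsto[OF hX v[of 0] hX v[of x]] by (simp add: hd dist_Pair_Pair)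
    have "mdist M (f (lam j *\<^sub>R 0)) (f (lam j *\<^sub>R x)) / lam j = norm x" for j
      using lam[of j] by (simp add: fd)
    then show "((\<lambda>j. mdist M (f (lam j *\<^sub>R 0)) (f (lam j *\<^sub>R x)) / lam j) \<longlongrightarrow> norm x) \<omega>"
      by simp
  qed
  define p where "p = (SOME p. p \<in> h (v 0, 1))"
  have P: "h (v 0, 1) \<in> mspace ?X" by (simp add: hX)
  have p: "p \<in> h (v 0, 1)" "p \<in> cone_seqs M b lam \<omega>"
    using some_in_class[OF P[unfolded mspace_asymptotic_cone]] by (simp_all add: p_def)
  show thesis
  proof
    show "p j \<in> mspace M" for j using cone_seqsD[OF p(2)] by auto
    show "((\<lambda>j. mdist M (p j) (f (lam j *\<^sub>R x)) / lam j) \<longlongrightarrow> sqrt (1 + (norm x)\<^sup>2)) \<omega>" for x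
      using mdist_asymptotic_cone_tendsto[OF P p(1) hX v[of x]]
      by (simp add: hd dist_Pair_Pair vd add.commute)
  qed
qed

theorem theoremB:
  fixes M :: "'a metric" and b :: 'a and lam :: "nat \<Rightarrow> real" and \<omega> :: "nat filter"
    and \<gamma> :: "'a set"
  assumes "mcomplete_of M" and "locally_compact_space (mtopology_of M)" and "CAT0_space M"
    and "nonprincipal_ultrafilter \<omega>"
    and "b \<in> mspace M"
    and "\<And>j. 0 < lam j" and "filterlim lam at_top \<omega>"
    and "flat TYPE('k::finite) M \<gamma>"
    and "bounds_half_flat TYPE('k) (asymptotic_cone M b lam \<omega>) (cone_limit M b lam \<omega> \<gamma>)"
  shows "bounds_half_flat TYPE('k) M \<gamma>"
proof -
  interpret cone_data M b lam \<omega> using assms by unfold_locales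
  obtain f :: "real^'k \<Rightarrow> 'a" where f: "isometric_embedding_on UNIV M f" and \<gamma>: "\<gamma> = range f"
    using assms(8) unfolding flat_def by blast
  obtain p where p: "\<And>j. p j \<in> mspace M"
    "\<And>x. ((\<lambda>j. mdist M (p j) (f (lam j *\<^sub>R x)) / lam j) \<longlongrightarrow> sqrt (1 + (norm x)\<^sup>2)) \<omega>"
    using height_one_sequence[OF assms(7) f assms(9)[unfolded \<gamma>]] by blast
  obtain h where h: "isometric_embedding_on (UNIV \<times> {0..}) M h" "\<And>x. h (x, 0::real) = f x"
    using half_flat_from_receding_points[OF assms(1-4) f p(1)
        receding_points_equidistant[OF assms(3) nb f p(1) lam assms(7) p(2)]] by blast
  have "h ` (UNIV \<times> {0}) = \<gamma>" using h(2) by (auto simp: \<gamma> image_iff)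
  with h(1) show ?thesis unfolding bounds_half_flat_def by blast
qed

end
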